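(* Let $(\gamma,\nu_1,\nu_2):I\to\mathbb{R}^3\times\Delta$ be a framed curve with curvature $(\ell,m,n,\alpha)$. (1) Suppose that there exist the framed curve $\mathcal{I}(\gamma,\nu_1,\nu_2):I\to\mathbb{R}^3\times\Delta$, where $(\lambda^{\mathcal I},\eta^{\mathcal I}):I\to\mathbb{R}^2$ is a smooth map such that $$-\lambda^{\mathcal I}m+\dot\eta^{\mathcal I}=0,\qquad \alpha+\dot\lambda^{\mathcal I}+\eta^{\mathcal I}m=0$$ on $I$ and $\theta^{\mathcal I}:I\to\mathbb{R}$ is a smooth function, and the framed curve $\mathcal{E}(\mathcal{I}(\gamma,\nu_1,\nu_2)):I\to\mathbb{R}^3\times\Delta$, where $(\lambda^{\mathcal E},\eta^{\mathcal E}):I\to\mathbb{R}^2$ is a smooth map with $$(\lambda^{\mathcal I}+\lambda^{\mathcal E}\cos\theta^{\mathcal I}+\eta^{\mathcal E}\sin\theta^{\mathcal I},\ \eta^{\mathcal I}-\lambda^{\mathcal E}\sin\theta^{\mathcal I}+\eta^{\mathcal E}\cos\theta^{\mathcal I})\not\equiv(0,0)$$ and $\theta^{\mathcal E}:I\to\mathbb{R}$ is a smooth function with $\theta^{\mathcal E}+\theta^{\mathcal I}\not\equiv0$ such that $$(\eta^{\mathcal I}-\lambda^{\mathcal E}\sin\theta^{\mathcal I}+\eta^{\mathcal E}\cos\theta^{\mathcal I})\ell-(\lambda^{\mathcal I}+\lambda^{\mathcal E}\cos\theta^{\mathcal I}+\eta^{\mathcal E}\sin\theta^{\mathcal I})n=0,$$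 $$\left(\dot\lambda^{\mathcal E}+\eta^{\mathcal E}(\dot\theta^{\mathcal I}+m)\right)\sin\theta^{\mathcal E}+\left(-\lambda^{\mathcal E}(\dot\theta^{\mathcal I}+m)+\dot\eta^{\mathcal E}\right)\cos\theta^{\mathcal E}=0$$ on $I$. Then the framed curves $(\gamma,\nu_1,\nu_2)$ and $\mathcal{E}(\mathcal{I}(\gamma,\nu_1,\nu_2))$ are $(\mu,\nu_1,\overline\nu_2)$-mates. (2) Suppose that there exist the framed curve $\mathcal{E}(\gamma,\nu_1,\nu_2):I\to\mathbb{R}^3\times\Delta$, where $(\lambda^{\mathcal E},\eta^{\mathcal E}):I\to\mathbb{R}^2$ is a smooth map and $\theta^{\mathcal E}:I\to\mathbb{R}$ is a smooth function such that $$\alpha+\lambda^{\mathcal E}m+\eta^{\mathcal E}n=0,\qquad (\dot\lambda^{\mathcal E}-\eta^{\mathcal E}\ell)\sin\theta^{\mathcal E}+(\lambda^{\mathcal E}\ell+\dot\eta^{\mathcal E})\cos\theta^{\mathcal E}=0$$ on $I$, and the framed curve $\mathcal{I}(\mathcal{E}(\gamma,\nu_1,\nu_2)):I\to\mathbb{R}^3\times\Delta$, where $(\lambda^{\mathcal I},\eta^{\mathcal I}):I\to\mathbb{R}^2$ is a smooth map with $$(\lambda^{\mathcal E}+\lambda^{\mathcal I}\cos\theta^{\mathcal E}+\eta^{\mathcal I}\sin\theta^{\mathcal E},\ \eta^{\mathcal E}-\lambda^{\mathcal I}\sin\theta^{\mathcal E}+\eta^{\mathcal I}\cos\theta^{\mathcal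 E})\not\equiv(0,0)$$ such that $$-\lambda^{\mathcal I}(\dot\theta^{\mathcal E}-\ell)+\dot\eta^{\mathcal I}=0,$$ $$\dot\lambda^{\mathcal I}+\eta^{\mathcal I}(\dot\theta^{\mathcal E}-\ell)+(\dot\lambda^{\mathcal E}-\eta^{\mathcal E}\ell)\cos\theta^{\mathcal E}-(\lambda^{\mathcal E}\ell+\dot\eta^{\mathcal E})\sin\theta^{\mathcal E}=0$$ on $I$. Then the framed curves $(\gamma,\nu_1,\nu_2)$ and $\mathcal{I}(\mathcal{E}(\gamma,\nu_1,\nu_2))$ are $(\nu_1,\nu_2,\overline\mu)$-mates.
   Context: All maps are $C^\infty$; $I\subset\mathbb{R}$ is an interval. Let $\Delta=\{(a,b)\in S^2\times S^2\mid a\cdot b=0\}$. A smooth map $(\gamma,\nu_1,\nu_2):I\to\mathbb{R}^3\times\Delta$ is a framed curve if $\dot\gamma\cdot\nu_1=\dot\gamma\cdot\nu_2=0$ on $I$. Put $\mu=\nu_1\times\nu_2$. The curvature $(\ell,m,n,\alpha)$ is $\ell=\dot\nu_1\cdot\nu_2$, $m=\dot\nu_1\cdot\mu$, $n=\dot\nu_2\cdot\mu$, $\alpha=\dot\gamma\cdot\mu$. Evolute: given a smooth map $(\lambda^{\mathcal E},\eta^{\mathcal E}):I\to\mathbb{R}^2$ and a smooth function $\theta^{\mathcal E}:I\to\mathbb{R}$ satisfying $$\alpha+\lambda^{\mathcal E}m+\eta^{\mathcal E}n=0,\qquad (\dot\lambda^{\mathcal E}-\eta^{\mathcal E}\ell)\sin\theta^{\mathcal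 E}+(\lambda^{\mathcal E}\ell+\dot\eta^{\mathcal E})\cos\theta^{\mathcal E}=0$$ on $I$, the framed curve $\mathcal{E}(\gamma,\nu_1,\nu_2)$ is $(\gamma+\lambda^{\mathcal E}\nu_1+\eta^{\mathcal E}\nu_2,\ \sin\theta^{\mathcal E}\nu_1+\cos\theta^{\mathcal E}\nu_2,\ \mu)$. Involute: given a smooth map $(\lambda^{\mathcal I},\eta^{\mathcal I}):I\to\mathbb{R}^2$ satisfying $$-\lambda^{\mathcal I}m+\dot\eta^{\mathcal I}=0,\qquad \alpha+\dot\lambda^{\mathcal I}+\eta^{\mathcal I}m=0$$ on $I$ and an arbitrary smooth function $\theta^{\mathcal I}:I\to\mathbb{R}$, the framed curve $\mathcal{I}(\gamma,\nu_1,\nu_2)$ is $(\gamma+\lambda^{\mathcal I}\mu+\eta^{\mathcal I}\nu_1,\ \cos\theta^{\mathcal I}\mu-\sin\theta^{\mathcal I}\nu_1,\ \sin\theta^{\mathcal I}\mu+\cos\theta^{\mathcal I}\nu_1)$. $\mathcal{E}(\mathcal{I}(\gamma,\nu_1,\nu_2))$ in (1) is the result of applying the evolute definition, with the functions $\lambda^{\mathcal E},\eta^{\mathcal E},\theta^{\mathcal E}$, to the framed curve $\mathcal{I}(\gamma,\nu_1,\nu_2)$ (with its own frame and curvature); the last two displayed equations in (1) are the evolute condition for that framed curve. $\mathcal{I}(\mathcal{E}(\gamma,\nu_1,\nu_2))$ in (2) is the result of applying the involute definition, with the functions $\lambda^{\mathcal I},\eta^{\mathcal I}$ and some smooth $\theta^{\mathcal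 I}$, to the framed curve $\mathcal{E}(\gamma,\nu_1,\nu_2)$; the last two displayed equations in (2) are the involute condition for that framed curve. For $v,w,x\in\{\nu_1,\nu_2,\mu\}$, framed curves $(\gamma,\nu_1,\nu_2)$ and $(\overline\gamma,\overline\nu_1,\overline\nu_2)$ (with $\overline\mu=\overline\nu_1\times\overline\nu_2$) are $(v,w,\overline x)$-mates if there exists a smooth map $(\lambda,\eta):I\to\mathbb{R}^2$ with $(\lambda,\eta)\not\equiv(0,0)$ such that $\overline\gamma=\gamma+\lambda v+\eta w$ and $v\times w=\overline x$ on $I$. For a function or map $f$ on $I$, $f\not\equiv0$ means that $f$ is not identically zero on any non-trivial subinterval of $I$. *)

theory Defs
  imports "HOL-Analysis.Analysis"
begin

definition nontrivial_interval :: "real set \<Rightarrow> bool" where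
  "nontrivial_interval J \<longleftrightarrow> is_interval J \<and> (\<exists>a\<in>J. \<exists>b\<in>J. a < b)"

(* At an end point of I contained in I this is the one-sided derivative. *)
definition deriv_on :: "real set \<Rightarrow> (real \<Rightarrow> 'a::real_normed_vector) \<Rightarrow> real \<Rightarrow> 'a" where
  "deriv_on I f t = vector_derivative f (at t within I)"

definition smooth_on :: "real set \<Rightarrow> (real \<Rightarrow> 'a::real_normed_vector) \<Rightarrow> bool" where
  "smooth_on I f \<longleftrightarrow> (\<forall>k. (deriv_on I ^^ k) f differentiable_on I)"

(* What is meant by f not being identically 0: on no non-trivial subinterval of I is f identically zero.
   This is stronger than f being different from the zero function on I. *)
definition nowhere_locally_zero :: "real set \<Rightarrow> (real \<Rightarrow> 'a::zero) \<Rightarrow> bool" where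
  "nowhere_locally_zero I f \<longleftrightarrow>
     (\<forall>J. J \<subseteq> I \<and> nontrivial_interval J \<longrightarrow> (\<exists>t\<in>J. f t \<noteq> 0))"

definition \<Delta> :: "((real^3) \<times> (real^3)) set" where
  "\<Delta> = {(a, b). a \<in> sphere 0 1 \<and> b \<in> sphere 0 1 \<and> a \<bullet> b = 0}"

type_synonym space_map = "real \<Rightarrow> real^3"

(* (\<gamma>, \<nu>1, \<nu>2), given by its three component maps *)
type_synonym frame_map = "space_map \<times> space_map \<times> space_map"

fun base :: "frame_map \<Rightarrow> space_map" where
  "base (\<gamma>, \<nu>1, \<nu>2) = \<gamma>"

datatype frame_vector = Nu1 | Nu2 | Mu

fun frame_field :: "frame_vector \<Rightarrow> frame_map \<Rightarrow> space_map" where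
  "frame_field Nu1 (\<gamma>, \<nu>1, \<nu>2) = \<nu>1"
| "frame_field Nu2 (\<gamma>, \<nu>1, \<nu>2) = \<nu>2"
| "frame_field Mu (\<gamma>, \<nu>1, \<nu>2) = (\<lambda>t. cross3 (\<nu>1 t) (\<nu>2 t))"

fun framed_curve :: "real set \<Rightarrow> frame_map \<Rightarrow> bool" where
  "framed_curve I (\<gamma>, \<nu>1, \<nu>2) \<longleftrightarrow>
     smooth_on I \<gamma> \<and> smooth_on I \<nu>1 \<and> smooth_on I \<nu>2 \<and>
     (\<forall>t\<in>I. (\<nu>1 t, \<nu>2 t) \<in> \<Delta> \<and>
            deriv_on I \<gamma> t \<bullet> \<nu>1 t = 0 \<and> deriv_on I \<gamma> t \<bullet> \<nu>2 t = 0)"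

fun curvature :: "real set \<Rightarrow> frame_map \<Rightarrow>
    (real \<Rightarrow> real) \<times> (real \<Rightarrow> real) \<times> (real \<Rightarrow> real) \<times> (real \<Rightarrow> real)" where
  "curvature I (\<gamma>, \<nu>1, \<nu>2) =
     (let \<mu> = frame_field Mu (\<gamma>, \<nu>1, \<nu>2) in
       (\<lambda>t. deriv_on I \<nu>1 t \<bullet> \<nu>2 t,
        \<lambda>t. deriv_on I \<nu>1 t \<bullet> \<mu> t,
        \<lambda>t. deriv_on I \<nu>2 t \<bullet> \<mu> t,
        \<lambda>t. deriv_on I \<gamma> t \<bullet> \<mu> t))"

(* The functions admitted in the definition of the evolute of the framed curve C. *)
definition evolute_data :: "real set \<Rightarrow> frame_map \<Rightarrow>
    (real \<Rightarrow> real) \<Rightarrow> (real \<Rightarrow> real) \<Rightarrow> (real \<Rightarrow> real) \<Rightarrow> bool" where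
  "evolute_data I C lam \<eta> \<theta> \<longleftrightarrow>
     smooth_on I lam \<and> smooth_on I \<eta> \<and> smooth_on I \<theta> \<and>
     (let (l, m, n, \<alpha>) = curvature I C in
       \<forall>t\<in>I. \<alpha> t + lam t * m t + \<eta> t * n t = 0 \<and>
             (deriv_on I lam t - \<eta> t * l t) * sin (\<theta> t)
               + (lam t * l t + deriv_on I \<eta> t) * cos (\<theta> t) = 0)"

fun evolute :: "frame_map \<Rightarrow> (real \<Rightarrow> real) \<Rightarrow> (real \<Rightarrow> real) \<Rightarrow> (real \<Rightarrow> real) \<Rightarrow> frame_map" where
  "evolute (\<gamma>, \<nu>1, \<nu>2) lam \<eta> \<theta> =
     (\<lambda>t. \<gamma> t + lam t *\<^sub>R \<nu>1 t + \<eta> t *\<^sub>R \<nu>2 t,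
      \<lambda>t. sin (\<theta> t) *\<^sub>R \<nu>1 t + cos (\<theta> t) *\<^sub>R \<nu>2 t,
      frame_field Mu (\<gamma>, \<nu>1, \<nu>2))"

(* The functions admitted in the definition of the involute of C; \<theta> is an arbitrary smooth function. *)
definition involute_data :: "real set \<Rightarrow> frame_map \<Rightarrow>
    (real \<Rightarrow> real) \<Rightarrow> (real \<Rightarrow> real) \<Rightarrow> (real \<Rightarrow> real) \<Rightarrow> bool" where
  "involute_data I C lam \<eta> \<theta> \<longleftrightarrow>
     smooth_on I lam \<and> smooth_on I \<eta> \<and> smooth_on I \<theta> \<and>
     (let (l, m, n, \<alpha>) = curvature I C in
       \<forall>t\<in>I. - lam t * m t + deriv_on I \<eta> t = 0 \<and>
             \<alpha> t + deriv_on I lam t + \<eta> t * m t = 0)"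

fun involute :: "frame_map \<Rightarrow> (real \<Rightarrow> real) \<Rightarrow> (real \<Rightarrow> real) \<Rightarrow> (real \<Rightarrow> real) \<Rightarrow> frame_map" where
  "involute (\<gamma>, \<nu>1, \<nu>2) lam \<eta> \<theta> =
     (let \<mu> = frame_field Mu (\<gamma>, \<nu>1, \<nu>2) in
       (\<lambda>t. \<gamma> t + lam t *\<^sub>R \<mu> t + \<eta> t *\<^sub>R \<nu>1 t,
        \<lambda>t. cos (\<theta> t) *\<^sub>R \<mu> t - sin (\<theta> t) *\<^sub>R \<nu>1 t,
        \<lambda>t. sin (\<theta> t) *\<^sub>R \<mu> t + cos (\<theta> t) *\<^sub>R \<nu>1 t))"

(* v and w select vectors of the frame of C, x one of the frame of D. *)
definition mates :: "real set \<Rightarrow> frame_vector \<Rightarrow> frame_vector \<Rightarrow> frame_vector \<Rightarrow>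
    frame_map \<Rightarrow> frame_map \<Rightarrow> bool" where
  "mates I v w x C D \<longleftrightarrow>
     framed_curve I C \<and> framed_curve I D \<and>
     (\<exists>lam \<eta>. smooth_on I lam \<and> smooth_on I \<eta> \<and>
        nowhere_locally_zero I (\<lambda>t. (lam t, \<eta> t)) \<and>
        (\<forall>t\<in>I. base D t = base C t + lam t *\<^sub>R frame_field v C t + \<eta> t *\<^sub>R frame_field w C t \<and>
               cross3 (frame_field v C t) (frame_field w C t) = frame_field x D t))"

end

theory Submission
  imports Defs
begin

text \<open>
  Let \<open>\<mu> = \<nu>1 \<times> \<nu>2\<close>. The second frame vector of an evolute is \<open>\<mu>\<close>, and its other two vectors are a
  rotation of \<open>\<nu>1, \<nu>2\<close> in their plane. The first two frame vectors of an involute are a rotation of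
  \<open>\<mu>, \<nu>1\<close> in their plane, so that its third vector is \<open>\<nu>2\<close>. Composing the two constructions
  leads back to the plane in which one started: the evolute of the involute is displaced from \<open>\<gamma>\<close>
  inside the plane of \<open>\<mu>\<close> and \<open>\<nu>1\<close>, and its second frame vector is \<open>\<nu>2 = \<mu> \<times> \<nu>1\<close>, while the
  involute of the evolute is displaced inside the plane of \<open>\<nu>1\<close> and \<open>\<nu>2\<close>, and its third frame vector
  is \<open>\<mu> = \<nu>1 \<times> \<nu>2\<close>. In both cases the coefficients of the displacement form the pair of functions
  assumed not to vanish identically on any nontrivial subinterval.

  It remains to see that the composed maps are framed curves. The frame equations
  (\<open>frame_equations\<close>) turn the derivatives of an evolute or an involute into combinations of the
  orthonormal frame \<open>\<nu>1, \<nu>2, \<mu>\<close> (\<open>evolute_derivatives\<close>, \<open>involute_derivatives\<close>), where one reads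
  off two things: that the conditions on the data of an evolute or involute say exactly that the
  new base curve is orthogonal to the new frame (\<open>framed_curve_evolute\<close>,
  \<open>framed_curve_involute\<close>), and the new curvature (\<open>curvature_evolute\<close>, \<open>curvature_involute\<close>).
  Inserting this curvature in the definition of the second construction shows that the equations
  assumed in the theorem are its data conditions.

  Smoothness is defined by iterating a derivative relative to the interval, so that sums, products
  and sines of smooth maps need an argument. It is carried out for finite orders of
  differentiability, where closure under products is an induction on the order.
\<close>

section \<open>Smooth maps on an interval\<close>

lemma at_within_nontrivial_interval:
  assumes "nontrivial_interval I" "t \<in> I"
  shows "at t within I \<noteq> bot"
proof -
  obtain a b where "a \<in> I" "b \<in> I" "a < b"
    using assms(1) by (auto simp: nontrivial_interval_def)
  then have "\<And>x. I \<noteq> {x}" by auto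
  moreover have "connected I"
    using assms(1) by (simp add: nontrivial_interval_def is_interval_connected_1)
  ultimately have "t islimpt I"
    using assms(2) by (intro connected_imp_perfect) auto
  then show ?thesis
    by (simp add: trivial_limit_within)
qed

lemma deriv_on_eqI:
  assumes "nontrivial_interval I" "t \<in> I" "(f has_vector_derivative f') (at t within I)"
  shows "deriv_on I f t = f'"
  unfolding deriv_on_def
  using vector_derivative_within[OF at_within_nontrivial_interval] assms by blast

lemma smooth_on_has_vector_derivative:
  assumes "smooth_on I f" "t \<in> I"
  shows "(f has_vector_derivative deriv_on I f t) (at t within I)"
proof -
  have "f differentiable_on I"
    using assms(1)[unfolded smooth_on_def, rule_format, of 0] by simp
  then show ?thesis
    unfolding deriv_on_def using assms(2) differentiable_onD vector_derivative_works by blast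
qed

lemma smooth_on_deriv_on:
  assumes "smooth_on I f"
  shows "smooth_on I (deriv_on I f)"
  unfolding smooth_on_def
proof
  fix k
  have "(deriv_on I ^^ Suc k) f differentiable_on I"
    using assms unfolding smooth_on_def by blast
  then show "(deriv_on I ^^ k) (deriv_on I f) differentiable_on I"
    by (simp add: funpow_swap1)
qed

text \<open>
  The derivative is existential rather than \<^const>\<open>deriv_on\<close>: it only matters on \<open>I\<close>, so that in
  closure proofs the expression given by a differentiation rule can be used as it is.
\<close>

primrec differentiable_upto :: "nat \<Rightarrow> real set \<Rightarrow> (real \<Rightarrow> 'a::real_normed_vector) \<Rightarrow> bool" where
  "differentiable_upto 0 I f \<longleftrightarrow> True"
| "differentiable_upto (Suc k) I f \<longleftrightarrow>
     (\<exists>f'. (\<forall>t\<in>I. (f has_vector_derivative f' t) (at t within I)) \<and> differentiable_upto k I f')"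

lemma differentiable_upto_SucI:
  assumes "\<And>t. t \<in> I \<Longrightarrow> (f has_vector_derivative f' t) (at t within I)"
    and "differentiable_upto k I f'"
  shows "differentiable_upto (Suc k) I f"
  using assms by auto

lemma differentiable_upto_cong:
  assumes "differentiable_upto k I f" "\<And>t. t \<in> I \<Longrightarrow> g t = f t"
  shows "differentiable_upto k I g"
proof (cases k)
  case (Suc j)
  then show ?thesis
    using assms by (auto intro: has_vector_derivative_transform)
qed simp

lemma differentiable_upto_Suc_imp: "differentiable_upto (Suc k) I f \<Longrightarrow> differentiable_upto k I f"
proof (induction k arbitrary: f)
  case (Suc k)
  from Suc.prems obtain f' where "\<forall>t\<in>I. (f has_vector_derivative f' t) (at t within I)"
    "differentiable_upto (Suc k) I f'"
    unfolding differentiable_upto.simps(2)[of "Suc k"] by blast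
  with Suc.IH show ?case
    unfolding differentiable_upto.simps(2)[of k] by blast
qed simp

lemma differentiable_upto_if_smooth_on: "smooth_on I f \<Longrightarrow> differentiable_upto k I f"
proof (induction k arbitrary: f)
  case (Suc k)
  then show ?case
    by (intro differentiable_upto_SucI[of I _ "deriv_on I f"] Suc.IH smooth_on_has_vector_derivative smooth_on_deriv_on)
qed simp

lemma funpow_deriv_on_differentiable:
  assumes "nontrivial_interval I"
  shows "differentiable_upto (Suc k) I f \<Longrightarrow> (deriv_on I ^^ k) f differentiable_on I"
proof (induction k arbitrary: f)
  case 0
  then show ?case
    by (auto simp: differentiable_on_def intro: differentiableI_vector)
next
  case (Suc k)
  obtain f' where f': "\<And>t. t \<in> I \<Longrightarrow> (f has_vector_derivative f' t) (at t within I)"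
    and smooth: "differentiable_upto (Suc k) I f'"
    using Suc.prems unfolding differentiable_upto.simps(2)[of "Suc k"] by blast
  have "differentiable_upto (Suc k) I (deriv_on I f)"
    by (rule differentiable_upto_cong[OF smooth]) (simp add: assms f' deriv_on_eqI)
  from Suc.IH[OF this] show ?case
    by (simp add: funpow_swap1)
qed

lemma smooth_on_iff_differentiable_upto:
  assumes "nontrivial_interval I"
  shows "smooth_on I f \<longleftrightarrow> (\<forall>k. differentiable_upto k I f)"
proof
  show "\<forall>k. differentiable_upto k I f" if "smooth_on I f"
    using differentiable_upto_if_smooth_on[OF that] by blast
  show "smooth_on I f" if "\<forall>k. differentiable_upto k I f"
    using funpow_deriv_on_differentiable[OF assms] that unfolding smooth_on_def by blast
qed

lemma differentiable_upto_const: "differentiable_upto k I (\<lambda>t. c)"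
proof (induction k arbitrary: c)
  case (Suc k)
  show ?case
    by (rule differentiable_upto_SucI[where f' = "\<lambda>t. 0"]) (auto intro: Suc.IH)
qed simp

lemma differentiable_upto_add:
  "differentiable_upto k I f \<Longrightarrow> differentiable_upto k I g \<Longrightarrow> differentiable_upto k I (\<lambda>t. f t + g t)"
proof (induction k arbitrary: f g)
  case (Suc k)
  obtain f' g' where "\<And>t. t \<in> I \<Longrightarrow> (f has_vector_derivative f' t) (at t within I)"
    "\<And>t. t \<in> I \<Longrightarrow> (g has_vector_derivative g' t) (at t within I)"
    "differentiable_upto k I f'" "differentiable_upto k I g'"
    using Suc.prems by auto
  then show ?case
    by (intro differentiable_upto_SucI[of I _ "\<lambda>t. f' t + g' t"] Suc.IH has_vector_derivative_add)
qed simp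

text \<open>One Leibniz argument covers multiplication, scaling, and the cross product.\<close>

lemma differentiable_upto_bilinear:
  assumes "bounded_bilinear p"
  shows "differentiable_upto k I f \<Longrightarrow> differentiable_upto k I g \<Longrightarrow>
    differentiable_upto k I (\<lambda>t. p (f t) (g t))"
proof (induction k arbitrary: f g)
  case (Suc k)
  obtain f' g' where D: "\<And>t. t \<in> I \<Longrightarrow> (f has_vector_derivative f' t) (at t within I)"
    "\<And>t. t \<in> I \<Longrightarrow> (g has_vector_derivative g' t) (at t within I)"
    "differentiable_upto k I f'" "differentiable_upto k I g'"
    using Suc.prems by auto
  have "differentiable_upto k I f" "differentiable_upto k I g"
    using Suc.prems differentiable_upto_Suc_imp by blast+
  with D have "differentiable_upto k I (\<lambda>t. p (f t) (g' t) + p (f' t) (g t))"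
    by (intro differentiable_upto_add Suc.IH)
  then show ?case
    by (rule differentiable_upto_SucI[rotated])
      (rule bounded_bilinear.has_vector_derivative[OF assms D(1,2)])
qed simp

text \<open>Sine and cosine are treated at once, each being the derivative of the other up to a sign.\<close>

lemma differentiable_upto_sin_cos:
  fixes f :: "real \<Rightarrow> real"
  shows "differentiable_upto k I f \<Longrightarrow>
    differentiable_upto k I (\<lambda>t. sin (f t)) \<and> differentiable_upto k I (\<lambda>t. cos (f t))"
proof (induction k)
  case (Suc k)
  obtain f' where D: "\<And>t. t \<in> I \<Longrightarrow> (f has_real_derivative f' t) (at t within I)"
    and f': "differentiable_upto k I f'"
    using Suc.prems by (auto simp: has_real_derivative_iff_has_vector_derivative)
  have IH: "differentiable_upto k I (\<lambda>t. sin (f t))" "differentiable_upto k I (\<lambda>t. cos (f t))"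
    using Suc.IH Suc.prems differentiable_upto_Suc_imp by blast+
  have "differentiable_upto k I (\<lambda>t. cos (f t) * f' t)"
    and "differentiable_upto k I (\<lambda>t. (- 1) * (sin (f t) * f' t))"
    by (intro differentiable_upto_bilinear[OF bounded_bilinear_mult] differentiable_upto_const IH f')+
  moreover have "((\<lambda>t. sin (f t)) has_vector_derivative cos (f t) * f' t) (at t within I)"
    and "((\<lambda>t. cos (f t)) has_vector_derivative (- 1) * (sin (f t) * f' t)) (at t within I)"
    if "t \<in> I" for t
    unfolding has_real_derivative_iff_has_vector_derivative[symmetric]
    by (auto intro!: derivative_eq_intros D that)
  ultimately show ?case
    by (intro conjI) (rule differentiable_upto_SucI; assumption)+
qed simp

context
  fixes I :: "real set"
  assumes I: "nontrivial_interval I"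
begin

lemma smooth_on_add: "smooth_on I f \<Longrightarrow> smooth_on I g \<Longrightarrow> smooth_on I (\<lambda>t. f t + g t)"
  using differentiable_upto_add smooth_on_iff_differentiable_upto[OF I] by blast

lemma smooth_on_bilinear:
  "bounded_bilinear p \<Longrightarrow> smooth_on I f \<Longrightarrow> smooth_on I g \<Longrightarrow> smooth_on I (\<lambda>t. p (f t) (g t))"
  unfolding smooth_on_iff_differentiable_upto[OF I] using differentiable_upto_bilinear by blast

lemmas smooth_on_mult = smooth_on_bilinear[OF bounded_bilinear_mult]
lemmas smooth_on_scaleR = smooth_on_bilinear[OF bounded_bilinear_scaleR]
lemmas smooth_on_cross3 = smooth_on_bilinear[OF bilinear_cross[unfolded bilinear_conv_bounded_bilinear]]

lemma smooth_on_diff: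
  assumes "smooth_on I f" "smooth_on I g"
  shows "smooth_on I (\<lambda>t. f t - g t)"
proof -
  have "smooth_on I (\<lambda>t. -1 :: real)"
    using differentiable_upto_const smooth_on_iff_differentiable_upto[OF I] by blast
  then have "smooth_on I (\<lambda>t. f t + (- 1) *\<^sub>R g t)"
    by (intro smooth_on_add smooth_on_scaleR assms)
  then show ?thesis by simp
qed

lemma
  fixes f :: "real \<Rightarrow> real"
  assumes "smooth_on I f"
  shows smooth_on_sin: "smooth_on I (\<lambda>t. sin (f t))"
    and smooth_on_cos: "smooth_on I (\<lambda>t. cos (f t))"
  using assms differentiable_upto_sin_cos smooth_on_iff_differentiable_upto[OF I] by blast+

end

lemmas smooth_on_intros =
  smooth_on_add smooth_on_diff smooth_on_mult smooth_on_scaleR smooth_on_cross3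
  smooth_on_sin smooth_on_cos

section \<open>Orthonormal frames and the frame equations\<close>

lemma orthonormal_cross3:
  assumes "norm a = 1" "norm b = 1" "a \<bullet> b = 0"
  shows "a \<bullet> a = 1" "b \<bullet> b = 1" "b \<bullet> a = 0" "cross3 a b \<bullet> cross3 a b = 1"
    "cross3 (cross3 a b) a = b" "cross3 a (cross3 a b) = - b"
    "cross3 (cross3 a b) b = - a" "cross3 b (cross3 a b) = a"
proof -
  show *: "a \<bullet> a = 1" "b \<bullet> b = 1" "b \<bullet> a = 0"
    using assms by (auto simp: norm_eq_1 inner_commute)
  show "cross3 a b \<bullet> cross3 a b = 1"
    using * by (simp add: dot_cross)
  show ab: "cross3 a (cross3 a b) = - b" "cross3 b (cross3 a b) = a"
    using * assms by (simp_all add: Lagrange)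
  show "cross3 (cross3 a b) a = b" "cross3 (cross3 a b) b = - a"
    using ab by (simp_all add: cross_skew[of "cross3 a b"])
qed

lemma orthonormal_expansion:
  assumes "norm a = 1" "norm b = 1" "a \<bullet> b = 0"
  shows "v = (v \<bullet> a) *\<^sub>R a + (v \<bullet> b) *\<^sub>R b + (v \<bullet> cross3 a b) *\<^sub>R cross3 a b"
proof -
  note on = orthonormal_cross3[OF assms]
  \<comment> \<open>The part of \<open>v\<close> orthogonal to \<open>\<mu> = a \<times> b\<close> is \<open>\<mu> \<times> (v \<times> \<mu>)\<close>; compute it in two ways.\<close>
  have "v - (v \<bullet> cross3 a b) *\<^sub>R cross3 a b = cross3 (cross3 a b) (cross3 v (cross3 a b))"
    unfolding Lagrange[of "cross3 a b"] by (simp add: on(4) inner_commute)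
  also have "\<dots> = cross3 (cross3 a b) ((v \<bullet> b) *\<^sub>R a - (v \<bullet> a) *\<^sub>R b)"
    by (simp add: Lagrange)
  also have "\<dots> = (v \<bullet> a) *\<^sub>R a + (v \<bullet> b) *\<^sub>R b"
    using on by (simp add: Cross3.right_diff_distrib cross_mult_right)
  finally show ?thesis by (simp add: algebra_simps)
qed

lemma inner_derivative_if_constant:
  assumes "nontrivial_interval I" "t \<in> I"
    and "(f has_vector_derivative f') (at t within I)" "(g has_vector_derivative g') (at t within I)"
    and "\<And>s. s \<in> I \<Longrightarrow> f s \<bullet> g s = c"
  shows "f t \<bullet> g' + f' \<bullet> g t = 0"
proof -
  have "((\<lambda>s. f s \<bullet> g s) has_vector_derivative f t \<bullet> g' + f' \<bullet> g t) (at t within I)"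
    by (rule bounded_bilinear.has_vector_derivative[OF bounded_bilinear_inner assms(3,4)])
  moreover have "((\<lambda>s. f s \<bullet> g s) has_vector_derivative 0) (at t within I)"
    by (rule has_vector_derivative_transform[OF assms(2), where f = "\<lambda>s. c"])
      (simp_all add: assms(5))
  ultimately show ?thesis
    using vector_derivative_unique_within[OF at_within_nontrivial_interval[OF assms(1,2)]] by blast
qed

lemma framed_curve_orthonormal:
  assumes "framed_curve I (\<gamma>, \<nu>1, \<nu>2)" "t \<in> I"
  shows "norm (\<nu>1 t) = 1" "norm (\<nu>2 t) = 1" "\<nu>1 t \<bullet> \<nu>2 t = 0"
  using assms by (auto simp: \<Delta>_def)

lemma framed_curveI:
  assumes "nontrivial_interval I" "smooth_on I \<gamma>" "smooth_on I \<nu>1" "smooth_on I \<nu>2"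
    and "\<And>t. t \<in> I \<Longrightarrow> \<nu>1 t \<bullet> \<nu>1 t = 1 \<and> \<nu>2 t \<bullet> \<nu>2 t = 1 \<and> \<nu>1 t \<bullet> \<nu>2 t = 0"
    and "\<And>t. t \<in> I \<Longrightarrow> (\<gamma> has_vector_derivative v t) (at t within I)"
    and "\<And>t. t \<in> I \<Longrightarrow> v t \<bullet> \<nu>1 t = 0 \<and> v t \<bullet> \<nu>2 t = 0"
  shows "framed_curve I (\<gamma>, \<nu>1, \<nu>2)"
proof -
  have "deriv_on I \<gamma> t = v t" if "t \<in> I" for t
    using assms(1,6) that by (intro deriv_on_eqI)
  then show ?thesis
    using assms by (simp add: \<Delta>_def norm_eq_1)
qed

text \<open>
  The frame being orthonormal, the matrix of its derivative with respect to itself is skew, so that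
  \<open>l, m, n\<close> are all its entries.
\<close>

lemma frame_equations:
  assumes I: "nontrivial_interval I" "t \<in> I"
    and C: "framed_curve I (\<gamma>, \<nu>1, \<nu>2)"
    and curv: "curvature I (\<gamma>, \<nu>1, \<nu>2) = (l, m, n, \<alpha>)"
  defines "\<mu> \<equiv> frame_field Mu (\<gamma>, \<nu>1, \<nu>2)"
  shows "(\<gamma> has_vector_derivative \<alpha> t *\<^sub>R \<mu> t) (at t within I)"
    and "(\<nu>1 has_vector_derivative l t *\<^sub>R \<nu>2 t + m t *\<^sub>R \<mu> t) (at t within I)"
    and "(\<nu>2 has_vector_derivative - l t *\<^sub>R \<nu>1 t + n t *\<^sub>R \<mu> t) (at t within I)"
    and "(\<mu> has_vector_derivative - m t *\<^sub>R \<nu>1 t - n t *\<^sub>R \<nu>2 t) (at t within I)"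
proof -
  have \<mu>: "\<mu> s = cross3 (\<nu>1 s) (\<nu>2 s)" for s
    by (simp add: \<mu>_def)
  note on = framed_curve_orthonormal[OF C]
  let ?d0 = "deriv_on I \<gamma> t" and ?d1 = "deriv_on I \<nu>1 t" and ?d2 = "deriv_on I \<nu>2 t"
  have D: "(\<gamma> has_vector_derivative ?d0) (at t within I)"
    "(\<nu>1 has_vector_derivative ?d1) (at t within I)"
    "(\<nu>2 has_vector_derivative ?d2) (at t within I)"
    using C I(2) by (auto intro: smooth_on_has_vector_derivative)
  have curv: "l t = ?d1 \<bullet> \<nu>2 t" "m t = ?d1 \<bullet> \<mu> t" "n t = ?d2 \<bullet> \<mu> t" "\<alpha> t = ?d0 \<bullet> \<mu> t"
    using curv by (auto simp: Let_def \<mu>)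
  have skew: "?d1 \<bullet> \<nu>1 t = 0" "?d2 \<bullet> \<nu>2 t = 0" "?d2 \<bullet> \<nu>1 t = - l t"
    using inner_derivative_if_constant[OF I D(2) D(2), of 1]
      inner_derivative_if_constant[OF I D(3) D(3), of 1]
      inner_derivative_if_constant[OF I D(2) D(3), of 0] on
    by (simp_all add: norm_eq_1 inner_commute curv)
  have expand: "v = (v \<bullet> \<nu>1 t) *\<^sub>R \<nu>1 t + (v \<bullet> \<nu>2 t) *\<^sub>R \<nu>2 t + (v \<bullet> \<mu> t) *\<^sub>R \<mu> t" for v
    unfolding \<mu> by (rule orthonormal_expansion[OF on[OF I(2)]])
  have "?d0 \<bullet> \<nu>1 t = 0" "?d0 \<bullet> \<nu>2 t = 0"
    using C I(2) by auto
  then have d0: "?d0 = \<alpha> t *\<^sub>R \<mu> t"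
    using expand[of ?d0] curv by simp
  have d1: "?d1 = l t *\<^sub>R \<nu>2 t + m t *\<^sub>R \<mu> t" and d2: "?d2 = - l t *\<^sub>R \<nu>1 t + n t *\<^sub>R \<mu> t"
    using expand[of ?d1] expand[of ?d2] curv skew by simp_all
  show "(\<gamma> has_vector_derivative \<alpha> t *\<^sub>R \<mu> t) (at t within I)"
    "(\<nu>1 has_vector_derivative l t *\<^sub>R \<nu>2 t + m t *\<^sub>R \<mu> t) (at t within I)"
    "(\<nu>2 has_vector_derivative - l t *\<^sub>R \<nu>1 t + n t *\<^sub>R \<mu> t) (at t within I)"
    using D unfolding d0 d1 d2 .
  have "(\<mu> has_vector_derivative cross3 (\<nu>1 t) ?d2 + cross3 ?d1 (\<nu>2 t)) (at t within I)"
    using bounded_bilinear.has_vector_derivative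
      [OF bilinear_cross[unfolded bilinear_conv_bounded_bilinear] D(2,3)]
    by (simp add: \<mu>_def)
  moreover have "cross3 (\<nu>1 t) ?d2 + cross3 ?d1 (\<nu>2 t) = - m t *\<^sub>R \<nu>1 t - n t *\<^sub>R \<nu>2 t"
    unfolding d1 d2 \<mu> cross_add_left cross_add_right cross_mult_left cross_mult_right
    by (simp add: orthonormal_cross3[OF on[OF I(2)]])
  ultimately show "(\<mu> has_vector_derivative - m t *\<^sub>R \<nu>1 t - n t *\<^sub>R \<nu>2 t) (at t within I)"
    by simp
qed

lemma curvature_eqI:
  assumes "nontrivial_interval I" "t \<in> I" "curvature I (\<gamma>, \<nu>1, \<nu>2) = (l, m, n, \<alpha>)"
    and "(\<gamma> has_vector_derivative d0) (at t within I)"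
    and "(\<nu>1 has_vector_derivative d1) (at t within I)"
    and "(\<nu>2 has_vector_derivative d2) (at t within I)"
    and "cross3 (\<nu>1 t) (\<nu>2 t) = w"
  shows "l t = d1 \<bullet> \<nu>2 t" "m t = d1 \<bullet> w" "n t = d2 \<bullet> w" "\<alpha> t = d0 \<bullet> w"
  using assms by (auto simp: Let_def deriv_on_eqI)

section \<open>Evolutes and involutes\<close>

text \<open>
  Both constructions rotate an orthonormal pair \<open>a, b\<close> of frame vectors into the pair
  \<open>u = sin \<theta> a + cos \<theta> b\<close>, \<open>w = cos \<theta> a - sin \<theta> b\<close>: the evolute with \<open>a = \<nu>1\<close>, \<open>b = \<nu>2\<close>, the
  involute with \<open>a = \<mu>\<close>, \<open>b = \<nu>1\<close>. The derivatives of \<open>u\<close> and \<open>w\<close> are expressed by \<open>u\<close> and \<open>w\<close>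
  themselves as far as possible, so that their contributions to the new curvature are coefficients.
\<close>

lemma rotated_pair_orthonormal:
  fixes a b :: "'a::real_inner" and x :: real
  assumes "a \<bullet> a = 1" "b \<bullet> b = 1" "a \<bullet> b = 0"
  defines "u \<equiv> sin x *\<^sub>R a + cos x *\<^sub>R b" and "w \<equiv> cos x *\<^sub>R a - sin x *\<^sub>R b"
  shows "u \<bullet> u = 1" "w \<bullet> w = 1" "u \<bullet> w = 0" "w \<bullet> u = 0"
  using assms(1-3) sin_cos_squared_add[of x]
  by (simp_all add: u_def w_def inner_simps inner_commute[of b a] power2_eq_square algebra_simps)

lemma rotated_pair_derivative:
  fixes a b :: "real \<Rightarrow> 'a::real_normed_vector"
  assumes "(\<theta> has_real_derivative \<theta>') (at t within I)"
    and "(a has_vector_derivative a') (at t within I)"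
    and "(b has_vector_derivative b') (at t within I)"
  shows "((\<lambda>t. sin (\<theta> t) *\<^sub>R a t + cos (\<theta> t) *\<^sub>R b t) has_vector_derivative
      \<theta>' *\<^sub>R (cos (\<theta> t) *\<^sub>R a t - sin (\<theta> t) *\<^sub>R b t)
      + (sin (\<theta> t) *\<^sub>R a' + cos (\<theta> t) *\<^sub>R b')) (at t within I)"
    and "((\<lambda>t. cos (\<theta> t) *\<^sub>R a t - sin (\<theta> t) *\<^sub>R b t) has_vector_derivative
      - \<theta>' *\<^sub>R (sin (\<theta> t) *\<^sub>R a t + cos (\<theta> t) *\<^sub>R b t)
      + (cos (\<theta> t) *\<^sub>R a' - sin (\<theta> t) *\<^sub>R b')) (at t within I)"
  by (auto intro!: derivative_eq_intros assms simp: algebra_simps)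

lemma smooth_on_has_real_derivative:
  assumes "smooth_on I f" "t \<in> I"
  shows "(f has_real_derivative deriv_on I f t) (at t within I)"
  unfolding has_real_derivative_iff_has_vector_derivative
  using assms by (rule smooth_on_has_vector_derivative)

lemma has_vector_derivative_displaced:
  fixes \<gamma> a b :: "real \<Rightarrow> 'a::real_normed_vector"
  assumes "(\<gamma> has_vector_derivative \<gamma>') (at t within I)"
    and "(lam has_real_derivative lam') (at t within I)"
    and "(\<eta> has_real_derivative \<eta>') (at t within I)"
    and "(a has_vector_derivative a') (at t within I)"
    and "(b has_vector_derivative b') (at t within I)"
  shows "((\<lambda>t. \<gamma> t + lam t *\<^sub>R a t + \<eta> t *\<^sub>R b t) has_vector_derivative
    \<gamma>' + (lam' *\<^sub>R a t + lam t *\<^sub>R a') + (\<eta>' *\<^sub>R b t + \<eta> t *\<^sub>R b')) (at t within I)"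
  by (auto intro!: derivative_eq_intros assms simp: algebra_simps)

context
  fixes I :: "real set" and \<gamma> \<nu>1 \<nu>2 \<mu> :: space_map and lam \<eta> \<theta> :: "real \<Rightarrow> real"
  assumes C: "framed_curve I (\<gamma>, \<nu>1, \<nu>2)"
  defines "\<mu> \<equiv> frame_field Mu (\<gamma>, \<nu>1, \<nu>2)"
begin

lemma \<mu>_eq: "\<mu> = (\<lambda>t. cross3 (\<nu>1 t) (\<nu>2 t))"
  by (simp add: \<mu>_def)

lemma frame_inner:
  assumes "t \<in> I"
  shows "\<nu>1 t \<bullet> \<nu>1 t = 1" "\<nu>2 t \<bullet> \<nu>2 t = 1" "\<mu> t \<bullet> \<mu> t = 1"
    "\<nu>1 t \<bullet> \<nu>2 t = 0" "\<nu>2 t \<bullet> \<nu>1 t = 0" "\<nu>1 t \<bullet> \<mu> t = 0" "\<mu> t \<bullet> \<nu>1 t = 0"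
    "\<nu>2 t \<bullet> \<mu> t = 0" "\<mu> t \<bullet> \<nu>2 t = 0"
  using framed_curve_orthonormal[OF C assms] orthonormal_cross3[OF framed_curve_orthonormal[OF C assms]]
  by (simp_all add: \<mu>_eq dot_cross_self)

lemma frame_cross3:
  assumes "t \<in> I"
  shows "cross3 (\<nu>1 t) (\<nu>2 t) = \<mu> t" "cross3 (\<mu> t) (\<nu>1 t) = \<nu>2 t" "cross3 (\<nu>1 t) (\<mu> t) = - \<nu>2 t"
    "cross3 (\<nu>2 t) (\<mu> t) = \<nu>1 t"
  using orthonormal_cross3[OF framed_curve_orthonormal[OF C assms]]
  by (simp_all add: \<mu>_eq)

lemma evolute_Mu:
  assumes "t \<in> I"
  shows "cross3 (sin (\<theta> t) *\<^sub>R \<nu>1 t + cos (\<theta> t) *\<^sub>R \<nu>2 t) (\<mu> t)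
    = cos (\<theta> t) *\<^sub>R \<nu>1 t - sin (\<theta> t) *\<^sub>R \<nu>2 t"
  by (simp add: cross_add_left cross_mult_left frame_cross3[OF assms])

lemma involute_Mu:
  assumes "t \<in> I"
  shows "cross3 (cos (\<theta> t) *\<^sub>R \<mu> t - sin (\<theta> t) *\<^sub>R \<nu>1 t) (sin (\<theta> t) *\<^sub>R \<mu> t + cos (\<theta> t) *\<^sub>R \<nu>1 t) = \<nu>2 t"
proof -
  have "cross3 (cos (\<theta> t) *\<^sub>R \<mu> t - sin (\<theta> t) *\<^sub>R \<nu>1 t) (sin (\<theta> t) *\<^sub>R \<mu> t + cos (\<theta> t) *\<^sub>R \<nu>1 t)
    = (cos (\<theta> t) * cos (\<theta> t)) *\<^sub>R \<nu>2 t + (sin (\<theta> t) * sin (\<theta> t)) *\<^sub>R \<nu>2 t"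
    unfolding Cross3.left_diff_distrib cross_add_right cross_mult_left cross_mult_right
      frame_cross3[OF assms]
    by simp
  also have "\<dots> = (cos (\<theta> t) * cos (\<theta> t) + sin (\<theta> t) * sin (\<theta> t)) *\<^sub>R \<nu>2 t"
    by (rule scaleR_add_left[symmetric])
  finally show ?thesis by simp
qed

context
  fixes l m n \<alpha> :: "real \<Rightarrow> real"
  assumes I: "nontrivial_interval I"
    and curv: "curvature I (\<gamma>, \<nu>1, \<nu>2) = (l, m, n, \<alpha>)"
begin

lemma smooth_frame: "smooth_on I \<gamma>" "smooth_on I \<nu>1" "smooth_on I \<nu>2" "smooth_on I \<mu>"
  using C by (auto simp: \<mu>_eq intro: smooth_on_cross3[OF I])

text \<open>
  The frame vectors of the evolute are \<open>u, \<mu>, w\<close> with \<open>u, w\<close> obtained by rotating \<open>\<nu>1, \<nu>2\<close>. The first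
  evolute equation removes the component of the derivative of the base curve along \<open>\<mu>\<close>.
\<close>

lemma evolute_derivatives:
  assumes E: "evolute_data I (\<gamma>, \<nu>1, \<nu>2) lam \<eta> \<theta>" and t: "t \<in> I"
  shows "((\<lambda>t. \<gamma> t + lam t *\<^sub>R \<nu>1 t + \<eta> t *\<^sub>R \<nu>2 t) has_vector_derivative
      (deriv_on I lam t - \<eta> t * l t) *\<^sub>R \<nu>1 t + (lam t * l t + deriv_on I \<eta> t) *\<^sub>R \<nu>2 t)
      (at t within I)"
    and "((\<lambda>t. sin (\<theta> t) *\<^sub>R \<nu>1 t + cos (\<theta> t) *\<^sub>R \<nu>2 t) has_vector_derivative
      (deriv_on I \<theta> t - l t) *\<^sub>R (cos (\<theta> t) *\<^sub>R \<nu>1 t - sin (\<theta> t) *\<^sub>R \<nu>2 t)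
      + (sin (\<theta> t) * m t + cos (\<theta> t) * n t) *\<^sub>R \<mu> t) (at t within I)"
proof -
  note frame = frame_equations[OF I t C curv, folded \<mu>_def]
  have smooth: "smooth_on I lam" "smooth_on I \<eta>" "smooth_on I \<theta>"
    and zero: "\<alpha> t + lam t * m t + \<eta> t * n t = 0"
    using E t curv by (auto simp: evolute_data_def)
  note D = smooth_on_has_real_derivative[OF _ t]
  have "\<alpha> t *\<^sub>R \<mu> t + (lam t * m t) *\<^sub>R \<mu> t + (\<eta> t * n t) *\<^sub>R \<mu> t = 0"
    using zero by (simp flip: scaleR_left.add)
  then have "\<alpha> t *\<^sub>R \<mu> t + (deriv_on I lam t *\<^sub>R \<nu>1 t + lam t *\<^sub>R (l t *\<^sub>R \<nu>2 t + m t *\<^sub>R \<mu> t))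
      + (deriv_on I \<eta> t *\<^sub>R \<nu>2 t + \<eta> t *\<^sub>R (- l t *\<^sub>R \<nu>1 t + n t *\<^sub>R \<mu> t))
    = (deriv_on I lam t - \<eta> t * l t) *\<^sub>R \<nu>1 t + (lam t * l t + deriv_on I \<eta> t) *\<^sub>R \<nu>2 t"
    by (simp add: algebra_simps)
  then show "((\<lambda>t. \<gamma> t + lam t *\<^sub>R \<nu>1 t + \<eta> t *\<^sub>R \<nu>2 t) has_vector_derivative
      (deriv_on I lam t - \<eta> t * l t) *\<^sub>R \<nu>1 t + (lam t * l t + deriv_on I \<eta> t) *\<^sub>R \<nu>2 t)
      (at t within I)"
    using has_vector_derivative_displaced[OF frame(1) D[OF smooth(1)] D[OF smooth(2)] frame(2,3)]
    by simp
  show "((\<lambda>t. sin (\<theta> t) *\<^sub>R \<nu>1 t + cos (\<theta> t) *\<^sub>R \<nu>2 t) has_vector_derivative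
      (deriv_on I \<theta> t - l t) *\<^sub>R (cos (\<theta> t) *\<^sub>R \<nu>1 t - sin (\<theta> t) *\<^sub>R \<nu>2 t)
      + (sin (\<theta> t) * m t + cos (\<theta> t) * n t) *\<^sub>R \<mu> t) (at t within I)"
    using rotated_pair_derivative(1)[OF D[OF smooth(3)] frame(2,3)]
    by (simp add: algebra_simps)
qed

lemma framed_curve_evolute:
  assumes E: "evolute_data I (\<gamma>, \<nu>1, \<nu>2) lam \<eta> \<theta>"
  shows "framed_curve I (evolute (\<gamma>, \<nu>1, \<nu>2) lam \<eta> \<theta>)"
proof -
  have smooth: "smooth_on I lam" "smooth_on I \<eta>" "smooth_on I \<theta>"
    and zero: "\<And>t. t \<in> I \<Longrightarrow> (deriv_on I lam t - \<eta> t * l t) * sin (\<theta> t)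
      + (lam t * l t + deriv_on I \<eta> t) * cos (\<theta> t) = 0"
    using E curv by (auto simp: evolute_data_def)
  show ?thesis
    unfolding evolute.simps \<mu>_def[symmetric]
  proof (rule framed_curveI[OF I _ _ _ _ evolute_derivatives(1)[OF E]], goal_cases)
    \<comment> \<open>Case 4 is orthonormality of the new frame, case 6 its orthogonality to the derivative of the
      base curve, where the second evolute equation enters; the others are smoothness.\<close>
    case (4 t)
    show ?case
      using rotated_pair_orthonormal(1)[of "\<nu>1 t" "\<nu>2 t" "\<theta> t"] frame_inner[OF 4]
      by (simp add: inner_add_left)
  next
    case (6 t)
    then show ?case
      using zero[OF 6] frame_inner[OF 6] by (simp add: inner_simps mult.commute)
  qed (intro smooth_on_intros I smooth smooth_frame | assumption)+
qed

lemma curvature_evolute: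
  assumes E: "evolute_data I (\<gamma>, \<nu>1, \<nu>2) lam \<eta> \<theta>" and t: "t \<in> I"
    and curvE: "curvature I (evolute (\<gamma>, \<nu>1, \<nu>2) lam \<eta> \<theta>) = (l', m', n', \<alpha>')"
  shows "l' t = sin (\<theta> t) * m t + cos (\<theta> t) * n t"
    and "m' t = deriv_on I \<theta> t - l t"
    and "n' t = sin (\<theta> t) * n t - cos (\<theta> t) * m t"
    and "\<alpha>' t = (deriv_on I lam t - \<eta> t * l t) * cos (\<theta> t) - (lam t * l t + deriv_on I \<eta> t) * sin (\<theta> t)"
proof -
  note inner = frame_inner[OF t] rotated_pair_orthonormal(2)[OF frame_inner(1,2,4)[OF t], of "\<theta> t"]
  note eqs = curvature_eqI[OF I t curvE[unfolded evolute.simps, folded \<mu>_def]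
      evolute_derivatives[OF E t] frame_equations(4)[OF I t C curv, folded \<mu>_def] evolute_Mu[OF t]]
  have w: "\<mu> t \<bullet> (cos (\<theta> t) *\<^sub>R \<nu>1 t - sin (\<theta> t) *\<^sub>R \<nu>2 t) = 0"
    "(cos (\<theta> t) *\<^sub>R \<nu>1 t - sin (\<theta> t) *\<^sub>R \<nu>2 t) \<bullet> \<mu> t = 0"
    by (simp_all add: inner inner_diff_left inner_diff_right)
  show "m' t = deriv_on I \<theta> t - l t" "l' t = sin (\<theta> t) * m t + cos (\<theta> t) * n t"
    unfolding eqs inner_add_left[of "_ *\<^sub>R _" "_ *\<^sub>R \<mu> t"] inner_scaleR_left[of _ "_ - _"]
      inner_scaleR_left[of _ "\<mu> t"] inner w
    by simp_all
  show "n' t = sin (\<theta> t) * n t - cos (\<theta> t) * m t"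
    "\<alpha>' t = (deriv_on I lam t - \<eta> t * l t) * cos (\<theta> t) - (lam t * l t + deriv_on I \<eta> t) * sin (\<theta> t)"
    unfolding eqs by (simp_all add: inner inner_simps)
qed

text \<open>
  The frame vectors of the involute are \<open>w, u, \<nu>2\<close> with \<open>u, w\<close> obtained by rotating \<open>\<mu>, \<nu>1\<close>. The
  involute equations remove from the derivative of the base curve the components in the plane of
  \<open>u\<close> and \<open>w\<close>; this is why the angle of an involute is arbitrary.
\<close>

lemma involute_derivatives:
  assumes D: "involute_data I (\<gamma>, \<nu>1, \<nu>2) lam \<eta> \<theta>" and t: "t \<in> I"
  shows "((\<lambda>t. \<gamma> t + lam t *\<^sub>R \<mu> t + \<eta> t *\<^sub>R \<nu>1 t) has_vector_derivative
      (\<eta> t * l t - lam t * n t) *\<^sub>R \<nu>2 t) (at t within I)"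
    and "((\<lambda>t. cos (\<theta> t) *\<^sub>R \<mu> t - sin (\<theta> t) *\<^sub>R \<nu>1 t) has_vector_derivative
      - (deriv_on I \<theta> t + m t) *\<^sub>R (sin (\<theta> t) *\<^sub>R \<mu> t + cos (\<theta> t) *\<^sub>R \<nu>1 t)
      + - (cos (\<theta> t) * n t + sin (\<theta> t) * l t) *\<^sub>R \<nu>2 t) (at t within I)"
    and "((\<lambda>t. sin (\<theta> t) *\<^sub>R \<mu> t + cos (\<theta> t) *\<^sub>R \<nu>1 t) has_vector_derivative
      (deriv_on I \<theta> t + m t) *\<^sub>R (cos (\<theta> t) *\<^sub>R \<mu> t - sin (\<theta> t) *\<^sub>R \<nu>1 t)
      + (cos (\<theta> t) * l t - sin (\<theta> t) * n t) *\<^sub>R \<nu>2 t) (at t within I)"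
proof -
  note frame = frame_equations[OF I t C curv, folded \<mu>_def]
  have smooth: "smooth_on I lam" "smooth_on I \<eta>" "smooth_on I \<theta>"
    and eqs: "deriv_on I \<eta> t = lam t * m t" "deriv_on I lam t = - \<alpha> t - \<eta> t * m t"
    using D t curv by (fastforce simp: involute_data_def)+
  note D = smooth_on_has_real_derivative[OF _ t]
  show "((\<lambda>t. \<gamma> t + lam t *\<^sub>R \<mu> t + \<eta> t *\<^sub>R \<nu>1 t) has_vector_derivative
      (\<eta> t * l t - lam t * n t) *\<^sub>R \<nu>2 t) (at t within I)"
    using has_vector_derivative_displaced[OF frame(1) D[OF smooth(1)] D[OF smooth(2)] frame(4,2)]
    unfolding eqs by (simp add: algebra_simps)
  show "((\<lambda>t. cos (\<theta> t) *\<^sub>R \<mu> t - sin (\<theta> t) *\<^sub>R \<nu>1 t) has_vector_derivative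
      - (deriv_on I \<theta> t + m t) *\<^sub>R (sin (\<theta> t) *\<^sub>R \<mu> t + cos (\<theta> t) *\<^sub>R \<nu>1 t)
      + - (cos (\<theta> t) * n t + sin (\<theta> t) * l t) *\<^sub>R \<nu>2 t) (at t within I)"
    by (rule has_vector_derivative_eq_rhs[OF rotated_pair_derivative(2)[OF D[OF smooth(3)] frame(4,2)]])
      (simp add: algebra_simps)
  show "((\<lambda>t. sin (\<theta> t) *\<^sub>R \<mu> t + cos (\<theta> t) *\<^sub>R \<nu>1 t) has_vector_derivative
      (deriv_on I \<theta> t + m t) *\<^sub>R (cos (\<theta> t) *\<^sub>R \<mu> t - sin (\<theta> t) *\<^sub>R \<nu>1 t)
      + (cos (\<theta> t) * l t - sin (\<theta> t) * n t) *\<^sub>R \<nu>2 t) (at t within I)"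
    using rotated_pair_derivative(1)[OF D[OF smooth(3)] frame(4,2)]
    by (simp add: algebra_simps)
qed

lemma framed_curve_involute:
  assumes D: "involute_data I (\<gamma>, \<nu>1, \<nu>2) lam \<eta> \<theta>"
  shows "framed_curve I (involute (\<gamma>, \<nu>1, \<nu>2) lam \<eta> \<theta>)"
proof -
  have smooth: "smooth_on I lam" "smooth_on I \<eta>" "smooth_on I \<theta>"
    using D curv by (auto simp: involute_data_def)
  show ?thesis
    unfolding involute.simps Let_def \<mu>_def[symmetric]
  proof (rule framed_curveI[OF I _ _ _ _ involute_derivatives(1)[OF D]], goal_cases)
    \<comment> \<open>As for the evolute; now the base curve moves along \<open>\<nu>2\<close>, which is orthogonal to every vector in
      the plane of \<open>\<mu>\<close> and \<open>\<nu>1\<close>.\<close>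
    case (4 t)
    show ?case
      using rotated_pair_orthonormal[OF frame_inner(3,1,7)[OF 4], of "\<theta> t"] by blast
  next
    case (6 t)
    then show ?case
      using frame_inner[OF 6] by (simp add: inner_simps)
  qed (intro smooth_on_intros I smooth smooth_frame | assumption)+
qed

lemma curvature_involute:
  assumes D: "involute_data I (\<gamma>, \<nu>1, \<nu>2) lam \<eta> \<theta>" and t: "t \<in> I"
    and curvI: "curvature I (involute (\<gamma>, \<nu>1, \<nu>2) lam \<eta> \<theta>) = (l', m', n', \<alpha>')"
  shows "l' t = - (deriv_on I \<theta> t + m t)"
    and "m' t = - (cos (\<theta> t) * n t + sin (\<theta> t) * l t)"
    and "n' t = cos (\<theta> t) * l t - sin (\<theta> t) * n t"
    and "\<alpha>' t = \<eta> t * l t - lam t * n t"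
proof -
  define u w where "u = sin (\<theta> t) *\<^sub>R \<mu> t + cos (\<theta> t) *\<^sub>R \<nu>1 t"
    and "w = cos (\<theta> t) *\<^sub>R \<mu> t - sin (\<theta> t) *\<^sub>R \<nu>1 t"
  have inner: "u \<bullet> u = 1" "\<nu>2 t \<bullet> u = 0" "u \<bullet> \<nu>2 t = 0" "w \<bullet> \<nu>2 t = 0" "\<nu>2 t \<bullet> \<nu>2 t = 1"
    using rotated_pair_orthonormal(1)[OF frame_inner(3,1,7)[OF t], of "\<theta> t"]
    by (simp_all add: u_def w_def inner_simps frame_inner[OF t])
  note eqs = curvature_eqI[OF I t curvI[unfolded involute.simps Let_def, folded \<mu>_def]
      involute_derivatives[OF D t] involute_Mu[OF t], folded u_def w_def]
  show "l' t = - (deriv_on I \<theta> t + m t)" "m' t = - (cos (\<theta> t) * n t + sin (\<theta> t) * l t)"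
    "n' t = cos (\<theta> t) * l t - sin (\<theta> t) * n t" "\<alpha>' t = \<eta> t * l t - lam t * n t"
    unfolding eqs inner_add_left inner_scaleR_left inner by simp_all
qed

end

end

section \<open>The composed constructions\<close>

lemma matesI:
  assumes "framed_curve I C" "framed_curve I D" "smooth_on I lam" "smooth_on I \<eta>"
    and "nowhere_locally_zero I (\<lambda>t. (lam t, \<eta> t))"
    and "\<And>t. t \<in> I \<Longrightarrow>
      base D t = base C t + lam t *\<^sub>R frame_field v C t + \<eta> t *\<^sub>R frame_field w C t"
    and "\<And>t. t \<in> I \<Longrightarrow> cross3 (frame_field v C t) (frame_field w C t) = frame_field x D t"
  shows "mates I v w x C D"
  unfolding mates_def using assms by blast

text \<open>
  The first assumed equation says that the displacement \<open>A \<mu> + B \<nu>1\<close> has a derivative orthogonal to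
  \<open>\<nu>2\<close>, which is the third vector of the involute; in terms of the curvature of the involute this is
  the first evolute equation. The second assumed equation is the second one, as the first curvature
  function of the involute is \<open>- (\<theta>' + m)\<close>.
\<close>

lemma evolute_involute_mates:
  assumes I: "nontrivial_interval I" and C: "framed_curve I (\<gamma>, \<nu>1, \<nu>2)"
    and curv: "curvature I (\<gamma>, \<nu>1, \<nu>2) = (l, m, n, \<alpha>)"
    and D: "involute_data I (\<gamma>, \<nu>1, \<nu>2) lamI \<eta>I \<theta>I"
    and smooth: "smooth_on I lamE" "smooth_on I \<eta>E" "smooth_on I \<theta>E"
    and nz: "nowhere_locally_zero I
          (\<lambda>t. (lamI t + lamE t * cos (\<theta>I t) + \<eta>E t * sin (\<theta>I t),
                \<eta>I t - lamE t * sin (\<theta>I t) + \<eta>E t * cos (\<theta>I t)))"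
    and eqs: "\<And>t. t \<in> I \<Longrightarrow>
          (\<eta>I t - lamE t * sin (\<theta>I t) + \<eta>E t * cos (\<theta>I t)) * l t
            - (lamI t + lamE t * cos (\<theta>I t) + \<eta>E t * sin (\<theta>I t)) * n t = 0"
      "\<And>t. t \<in> I \<Longrightarrow> (deriv_on I lamE t + \<eta>E t * (deriv_on I \<theta>I t + m t)) * sin (\<theta>E t)
            + (- lamE t * (deriv_on I \<theta>I t + m t) + deriv_on I \<eta>E t) * cos (\<theta>E t) = 0"
  shows "mates I Mu Nu1 Nu2 (\<gamma>, \<nu>1, \<nu>2)
    (evolute (involute (\<gamma>, \<nu>1, \<nu>2) lamI \<eta>I \<theta>I) lamE \<eta>E \<theta>E)"
proof -
  let ?D = "involute (\<gamma>, \<nu>1, \<nu>2) lamI \<eta>I \<theta>I"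
  obtain l' m' n' \<alpha>' where curv': "curvature I ?D = (l', m', n', \<alpha>')"
    using prod_cases4 by blast
  have "evolute_data I ?D lamE \<eta>E \<theta>E"
    unfolding evolute_data_def curv' Let_def prod.case
  proof (intro conjI ballI smooth)
    fix t assume t: "t \<in> I"
    note c = curvature_involute[OF C I curv D t curv']
    show "\<alpha>' t + lamE t * m' t + \<eta>E t * n' t = 0"
      using eqs(1)[OF t] unfolding c by (simp add: algebra_simps)
    show "(deriv_on I lamE t - \<eta>E t * l' t) * sin (\<theta>E t)
        + (lamE t * l' t + deriv_on I \<eta>E t) * cos (\<theta>E t) = 0"
      using eqs(2)[OF t] unfolding c by (simp add: algebra_simps)
  qed
  moreover have "framed_curve I ?D"
    by (rule framed_curve_involute[OF C I curv D])
  ultimately have "framed_curve I (evolute ?D lamE \<eta>E \<theta>E)"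
    using curv' framed_curve_evolute[OF _ I] prod_cases3[of ?D] by metis
  moreover have "smooth_on I lamI" "smooth_on I \<eta>I" "smooth_on I \<theta>I"
    using D by (auto simp: involute_data_def)
  ultimately show ?thesis
  proof (intro matesI[OF C _ _ _ nz])
    fix t assume t: "t \<in> I"
    show "base (evolute ?D lamE \<eta>E \<theta>E) t = base (\<gamma>, \<nu>1, \<nu>2) t
        + (lamI t + lamE t * cos (\<theta>I t) + \<eta>E t * sin (\<theta>I t)) *\<^sub>R frame_field Mu (\<gamma>, \<nu>1, \<nu>2) t
        + (\<eta>I t - lamE t * sin (\<theta>I t) + \<eta>E t * cos (\<theta>I t)) *\<^sub>R frame_field Nu1 (\<gamma>, \<nu>1, \<nu>2) t"
      by (simp add: Let_def algebra_simps)
    show "cross3 (frame_field Mu (\<gamma>, \<nu>1, \<nu>2) t) (frame_field Nu1 (\<gamma>, \<nu>1, \<nu>2) t)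
        = frame_field Nu2 (evolute ?D lamE \<eta>E \<theta>E) t"
      using involute_Mu[OF C t, of \<theta>I] frame_cross3(2)[OF C t] by (simp add: Let_def)
  qed (intro smooth_on_intros I smooth | assumption)+
qed

text \<open>
  An involute equation involves only \<open>m\<close> and \<open>\<alpha>\<close>. For the evolute these are the rate
  \<open>\<theta>' - l\<close> at which its first frame vector \<open>u\<close> turns towards its third one \<open>w\<close>, and the component
  along \<open>w\<close> of the derivative of its base curve; substituting them gives the assumed equations.
\<close>

lemma involute_evolute_mates:
  assumes I: "nontrivial_interval I" and C: "framed_curve I (\<gamma>, \<nu>1, \<nu>2)"
    and curv: "curvature I (\<gamma>, \<nu>1, \<nu>2) = (l, m, n, \<alpha>)"
    and E: "evolute_data I (\<gamma>, \<nu>1, \<nu>2) lamE \<eta>E \<theta>E"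
    and smooth: "smooth_on I lamI" "smooth_on I \<eta>I" "smooth_on I \<theta>I"
    and nz: "nowhere_locally_zero I
          (\<lambda>t. (lamE t + lamI t * cos (\<theta>E t) + \<eta>I t * sin (\<theta>E t),
                \<eta>E t - lamI t * sin (\<theta>E t) + \<eta>I t * cos (\<theta>E t)))"
    and eqs: "\<And>t. t \<in> I \<Longrightarrow> - lamI t * (deriv_on I \<theta>E t - l t) + deriv_on I \<eta>I t = 0"
      "\<And>t. t \<in> I \<Longrightarrow> deriv_on I lamI t + \<eta>I t * (deriv_on I \<theta>E t - l t)
            + (deriv_on I lamE t - \<eta>E t * l t) * cos (\<theta>E t)
            - (lamE t * l t + deriv_on I \<eta>E t) * sin (\<theta>E t) = 0"
  shows "mates I Nu1 Nu2 Mu (\<gamma>, \<nu>1, \<nu>2)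
    (involute (evolute (\<gamma>, \<nu>1, \<nu>2) lamE \<eta>E \<theta>E) lamI \<eta>I \<theta>I)"
proof -
  let ?E = "evolute (\<gamma>, \<nu>1, \<nu>2) lamE \<eta>E \<theta>E"
  obtain l' m' n' \<alpha>' where curv': "curvature I ?E = (l', m', n', \<alpha>')"
    using prod_cases4 by blast
  have data: "involute_data I ?E lamI \<eta>I \<theta>I"
    unfolding involute_data_def curv' Let_def prod.case
  proof (intro conjI ballI smooth)
    fix t assume t: "t \<in> I"
    note c = curvature_evolute[OF C I curv E t curv']
    show "- lamI t * m' t + deriv_on I \<eta>I t = 0"
      using eqs(1)[OF t] unfolding c .
    show "\<alpha>' t + deriv_on I lamI t + \<eta>I t * m' t = 0"
      using eqs(2)[OF t] unfolding c by (simp add: algebra_simps)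
  qed
  have framedE: "framed_curve I ?E"
    by (rule framed_curve_evolute[OF C I curv E])
  then have "framed_curve I (involute ?E lamI \<eta>I \<theta>I)"
    using curv' data framed_curve_involute[OF _ I] prod_cases3[of ?E] by metis
  moreover have "smooth_on I lamE" "smooth_on I \<eta>E" "smooth_on I \<theta>E"
    using E by (auto simp: evolute_data_def)
  ultimately show ?thesis
  proof (intro matesI[OF C _ _ _ nz])
    fix t assume t: "t \<in> I"
    show "base (involute ?E lamI \<eta>I \<theta>I) t = base (\<gamma>, \<nu>1, \<nu>2) t
        + (lamE t + lamI t * cos (\<theta>E t) + \<eta>I t * sin (\<theta>E t)) *\<^sub>R frame_field Nu1 (\<gamma>, \<nu>1, \<nu>2) t
        + (\<eta>E t - lamI t * sin (\<theta>E t) + \<eta>I t * cos (\<theta>E t)) *\<^sub>R frame_field Nu2 (\<gamma>, \<nu>1, \<nu>2) t"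
      unfolding evolute.simps involute.simps base.simps frame_field.simps Let_def
        evolute_Mu[OF C t, unfolded frame_field.simps]
      by (simp add: algebra_simps)
    show "cross3 (frame_field Nu1 (\<gamma>, \<nu>1, \<nu>2) t) (frame_field Nu2 (\<gamma>, \<nu>1, \<nu>2) t)
        = frame_field Mu (involute ?E lamI \<eta>I \<theta>I) t"
      using involute_Mu[OF framedE[unfolded evolute.simps] t, of \<theta>I] by (simp add: Let_def)
  qed (intro smooth_on_intros I smooth | assumption)+
qed

theorem theorem6p9:
  fixes I :: "real set" and \<gamma> \<nu>1 \<nu>2 :: "real \<Rightarrow> real^3"
    and l m n \<alpha> :: "real \<Rightarrow> real"
  assumes "nontrivial_interval I"
    and "framed_curve I (\<gamma>, \<nu>1, \<nu>2)"
    and "curvature I (\<gamma>, \<nu>1, \<nu>2) = (l, m, n, \<alpha>)"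
  shows
    "(\<forall>lamI \<eta>I \<theta>I lamE \<eta>E \<theta>E.
        involute_data I (\<gamma>, \<nu>1, \<nu>2) lamI \<eta>I \<theta>I \<and>
        smooth_on I lamE \<and> smooth_on I \<eta>E \<and> smooth_on I \<theta>E \<and>
        nowhere_locally_zero I
          (\<lambda>t. (lamI t + lamE t * cos (\<theta>I t) + \<eta>E t * sin (\<theta>I t),
                \<eta>I t - lamE t * sin (\<theta>I t) + \<eta>E t * cos (\<theta>I t))) \<and>
        nowhere_locally_zero I (\<lambda>t. \<theta>E t + \<theta>I t) \<and>
        (\<forall>t\<in>I.
          (\<eta>I t - lamE t * sin (\<theta>I t) + \<eta>E t * cos (\<theta>I t)) * l t
            - (lamI t + lamE t * cos (\<theta>I t) + \<eta>E t * sin (\<theta>I t)) * n t = 0 \<and>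
          (deriv_on I lamE t + \<eta>E t * (deriv_on I \<theta>I t + m t)) * sin (\<theta>E t)
            + (- lamE t * (deriv_on I \<theta>I t + m t) + deriv_on I \<eta>E t) * cos (\<theta>E t) = 0)
        \<longrightarrow> mates I Mu Nu1 Nu2 (\<gamma>, \<nu>1, \<nu>2)
              (evolute (involute (\<gamma>, \<nu>1, \<nu>2) lamI \<eta>I \<theta>I) lamE \<eta>E \<theta>E))
     \<and>
     (\<forall>lamE \<eta>E \<theta>E lamI \<eta>I \<theta>I.
        evolute_data I (\<gamma>, \<nu>1, \<nu>2) lamE \<eta>E \<theta>E \<and>
        smooth_on I lamI \<and> smooth_on I \<eta>I \<and> smooth_on I \<theta>I \<and>
        nowhere_locally_zero I
          (\<lambda>t. (lamE t + lamI t * cos (\<theta>E t) + \<eta>I t * sin (\<theta>E t),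
                \<eta>E t - lamI t * sin (\<theta>E t) + \<eta>I t * cos (\<theta>E t))) \<and>
        (\<forall>t\<in>I.
          - lamI t * (deriv_on I \<theta>E t - l t) + deriv_on I \<eta>I t = 0 \<and>
          deriv_on I lamI t + \<eta>I t * (deriv_on I \<theta>E t - l t)
            + (deriv_on I lamE t - \<eta>E t * l t) * cos (\<theta>E t)
            - (lamE t * l t + deriv_on I \<eta>E t) * sin (\<theta>E t) = 0)
        \<longrightarrow> mates I Nu1 Nu2 Mu (\<gamma>, \<nu>1, \<nu>2)
              (involute (evolute (\<gamma>, \<nu>1, \<nu>2) lamE \<eta>E \<theta>E) lamI \<eta>I \<theta>I))"
  using evolute_involute_mates[OF assms] involute_evolute_mates[OF assms]
  by (intro conjI allI impI) simp_all

end
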